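(* Let $(K,K_0,L_0)$ be a weak indifferent set and let $U$ be the subgroup of $\mathrm{PSp}_4(L_0,K_0)$ generated by the positive root groups. Then $U$ is definable in the structure $(K_0,L_0,+,* )$, and $(K_0,L_0,+,* )$ is definable in $U$, where $(K_0,L_0,+,* )$ is the additive group $K_0$ with a unary predicate for $L_0$ and the binary operation $a*b=a^2b$ on $K_0$.
   Context: A weak indifferent set is a triple $(K,K_0,L_0)$ where $K$ is a field of characteristic $2$ and $K_0,L_0$ are additive subgroups with $K^2\le L_0\le K_0\le K$, such that $L_0$ is a vector space over $K_0^2$ and $K_0$ is a vector space over the subfield of $K$ generated by $L_0$. $\mathrm{PSp}_4(L_0,K_0)$ is the subgroup of $\mathrm{PSp}_4(K)$ generated by the root subgroups $x_\gamma(K_0)$ for $\gamma$ short and $x_\gamma(L_0)$ for $\gamma$ long. Concretely $U$ is generated by root groups $U_1,U_2,U_3,U_4$, $U_i=\{x_i(c)\}$ with $c\in K_0$ for $i=1,3$ and $c\in L_0$ for $i=2,4$, with relations $[x_1(t),x_4(a)]=x_2(t^2a)x_3(ta)$ ($t\in K_0$, $a\in L_0$) and all other pairs $U_i,U_j$ commuting. "Definable in" is meant in the sense of model-theoretic interpretability (parameters allowed). *)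

theory Defs
  imports "HOL-Analysis.Cartesian_Space" "HOL-Algebra.Generated_Groups"
begin

section \<open>First-order structures, definability and interpretability\<close>

datatype 'f trm = Var nat | Fn 'f "'f trm list"

datatype ('f, 'r) fm =
    Eq "'f trm" "'f trm"
  | Rl 'r "'f trm list"
  | Neg "('f, 'r) fm"
  | Conj "('f, 'r) fm" "('f, 'r) fm"
  | Ex nat "('f, 'r) fm"

text \<open>
  The signature is part of the structure: \<open>funs\<close> and \<open>rels\<close> are the sets of function and relation
  symbols together with their arities (constants are function symbols of arity \<open>0\<close>).
  The values of \<open>fun_int\<close> and \<open>rel_int\<close> on lists of the wrong length are irrelevant, because only
  well-formed formulas are used below.
\<close>

record ('f, 'r, 'a) fo_structure =
  universe :: "'a set"
  funs :: "('f \<times> nat) set"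
  rels :: "('r \<times> nat) set"
  fun_int :: "'f \<Rightarrow> 'a list \<Rightarrow> 'a"
  rel_int :: "'r \<Rightarrow> 'a list \<Rightarrow> bool"

fun wf_trm :: "('f, 'r, 'a) fo_structure \<Rightarrow> 'f trm \<Rightarrow> bool" where
  "wf_trm M (Var x) \<longleftrightarrow> True"
| "wf_trm M (Fn g ts) \<longleftrightarrow> (g, length ts) \<in> funs M \<and> (\<forall>t\<in>set ts. wf_trm M t)"

fun wf_fm :: "('f, 'r, 'a) fo_structure \<Rightarrow> ('f, 'r) fm \<Rightarrow> bool" where
  "wf_fm M (Eq s t) \<longleftrightarrow> wf_trm M s \<and> wf_trm M t"
| "wf_fm M (Rl r ts) \<longleftrightarrow> (r, length ts) \<in> rels M \<and> (\<forall>t\<in>set ts. wf_trm M t)"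
| "wf_fm M (Neg p) \<longleftrightarrow> wf_fm M p"
| "wf_fm M (Conj p q) \<longleftrightarrow> wf_fm M p \<and> wf_fm M q"
| "wf_fm M (Ex x p) \<longleftrightarrow> wf_fm M p"

fun trm_val :: "('f, 'r, 'a) fo_structure \<Rightarrow> (nat \<Rightarrow> 'a) \<Rightarrow> 'f trm \<Rightarrow> 'a" where
  "trm_val M e (Var x) = e x"
| "trm_val M e (Fn g ts) = fun_int M g (map (trm_val M e) ts)"

fun sat :: "('f, 'r, 'a) fo_structure \<Rightarrow> (nat \<Rightarrow> 'a) \<Rightarrow> ('f, 'r) fm \<Rightarrow> bool" where
  "sat M e (Eq s t) \<longleftrightarrow> trm_val M e s = trm_val M e t"
| "sat M e (Rl r ts) \<longleftrightarrow> rel_int M r (map (trm_val M e) ts)"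
| "sat M e (Neg p) \<longleftrightarrow> \<not> sat M e p"
| "sat M e (Conj p q) \<longleftrightarrow> sat M e p \<and> sat M e q"
| "sat M e (Ex x p) \<longleftrightarrow> (\<exists>a\<in>universe M. sat M (e(x := a)) p)"

definition tuples :: "'a set \<Rightarrow> nat \<Rightarrow> 'a list set" where
  "tuples A n = {xs. set xs \<subseteq> A \<and> length xs = n}"

text \<open>
  Definability with parameters of a set of \<open>n\<close>-tuples: the variables \<open>0, \<dots>, n - 1\<close> are the
  coordinates of the tuple, all other free variables are parameters, with values given by \<open>e\<close>.
  A formula has finitely many variables, so only finitely many parameters are used.
\<close>

definition definable :: "('f, 'r, 'a) fo_structure \<Rightarrow> nat \<Rightarrow> 'a list set \<Rightarrow> bool" where
  "definable M n X \<longleftrightarrow> (\<exists>p e. wf_fm M p \<and> range e \<subseteq> universe M \<and>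
     X = {xs \<in> tuples (universe M) n. sat M (\<lambda>i. if i < n then xs ! i else e i) p})"

text \<open>
  \<open>n\<close>-dimensional interpretation of \<open>N\<close> in \<open>M\<close> with domain \<open>D\<close> and coordinate map \<open>h\<close>:
  the domain, the kernel of \<open>h\<close>, and the inverse images under \<open>h\<close> of the (graphs of the) functions
  and relations of \<open>N\<close> are definable in \<open>M\<close>. Thus \<open>N\<close> is isomorphic to a structure on a definable
  set of \<open>n\<close>-tuples modulo a definable equivalence relation. Tuples of \<open>n\<close>-tuples are concatenated.
\<close>

definition interprets_via ::
  "('f, 'r, 'a) fo_structure \<Rightarrow> ('g, 's, 'b) fo_structure \<Rightarrow> nat \<Rightarrow> 'a list set \<Rightarrow> ('a list \<Rightarrow> 'b) \<Rightarrow> bool"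
  where
  "interprets_via M N n D h \<longleftrightarrow>
     0 < n \<and> definable M n D \<and> h ` D = universe N \<and>
     definable M (n + n) {xs @ ys | xs ys. xs \<in> D \<and> ys \<in> D \<and> h xs = h ys} \<and>
     (\<forall>(g, k) \<in> funs N. definable M (k * n + n)
        {concat xss @ ys | xss ys. xss \<in> tuples D k \<and> ys \<in> D \<and> fun_int N g (map h xss) = h ys}) \<and>
     (\<forall>(r, k) \<in> rels N. definable M (k * n)
        {concat xss | xss. xss \<in> tuples D k \<and> rel_int N r (map h xss)})"

definition interpretable_in ::
  "('g, 's, 'b) fo_structure \<Rightarrow> ('f, 'r, 'a) fo_structure \<Rightarrow> bool" (infix \<open>interpretable'_in\<close> 50)
  where
  "N interpretable_in M \<longleftrightarrow> (\<exists>n D h. interprets_via M N n D h)"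

datatype group_sym = Mult | Inv | Unit

fun group_sym_int :: "('a, 'm) monoid_scheme \<Rightarrow> group_sym \<Rightarrow> 'a list \<Rightarrow> 'a" where
  "group_sym_int G Mult xs = xs ! 0 \<otimes>\<^bsub>G\<^esub> xs ! 1"
| "group_sym_int G Inv xs = inv\<^bsub>G\<^esub> (xs ! 0)"
| "group_sym_int G Unit xs = \<one>\<^bsub>G\<^esub>"

definition group_structure :: "('a, 'm) monoid_scheme \<Rightarrow> (group_sym, unit, 'a) fo_structure" where
  "group_structure G = \<lparr>universe = carrier G, funs = {(Mult, 2), (Inv, 1), (Unit, 0)}, rels = {},
     fun_int = group_sym_int G, rel_int = (\<lambda>_ _. False)\<rparr>"


section \<open>Weak indifferent sets\<close>

definition additive_subgrp :: "'k::field set \<Rightarrow> bool" where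
  "additive_subgrp A \<longleftrightarrow> 0 \<in> A \<and> (\<forall>x\<in>A. \<forall>y\<in>A. x - y \<in> A)"

definition is_subfield :: "'k::field set \<Rightarrow> bool" where
  "is_subfield F \<longleftrightarrow> additive_subgrp F \<and> 1 \<in> F \<and> (\<forall>x\<in>F. \<forall>y\<in>F. x * y \<in> F) \<and> (\<forall>x\<in>F. inverse x \<in> F)"

text \<open>
  The set of squares of \<open>K\<^sub>0\<close> need not be a subfield; being a vector space over it means being
  a vector space over the subfield it generates.
\<close>

definition weak_indifferent_set :: "'k::field set \<Rightarrow> 'k set \<Rightarrow> bool" where
  "weak_indifferent_set K0 L0 \<longleftrightarrow>
     CHAR('k) = 2 \<and> additive_subgrp K0 \<and> additive_subgrp L0 \<and>
     range (\<lambda>x. x\<^sup>2) \<subseteq> L0 \<and> L0 \<subseteq> K0 \<and>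
     (\<forall>c \<in> is_subfield hull ((\<lambda>x. x\<^sup>2) ` K0). \<forall>a\<in>L0. c * a \<in> L0) \<and>
     (\<forall>c \<in> is_subfield hull L0. \<forall>t\<in>K0. c * t \<in> K0)"

datatype indiff_fun = Plus | Star
datatype indiff_rel = InL0

fun indiff_fun_int :: "indiff_fun \<Rightarrow> 'k::field list \<Rightarrow> 'k" where
  "indiff_fun_int Plus xs = xs ! 0 + xs ! 1"
| "indiff_fun_int Star xs = (xs ! 0)\<^sup>2 * xs ! 1"

fun indiff_rel_int :: "'k set \<Rightarrow> indiff_rel \<Rightarrow> 'k list \<Rightarrow> bool" where
  "indiff_rel_int L0 InL0 xs \<longleftrightarrow> xs ! 0 \<in> L0"

definition indiff_structure ::
  "'k::field set \<Rightarrow> 'k set \<Rightarrow> (indiff_fun, indiff_rel, 'k) fo_structure" where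
  "indiff_structure K0 L0 = \<lparr>universe = K0, funs = {(Plus, 2), (Star, 2)}, rels = {(InL0, 1)},
     fun_int = indiff_fun_int, rel_int = indiff_rel_int L0\<rparr>"


section \<open>The groups \<open>PSp\<^sub>4(K)\<close>, \<open>PSp\<^sub>4(L\<^sub>0, K\<^sub>0)\<close> and \<open>U\<close>\<close>

definition E4 :: "4 \<Rightarrow> 4 \<Rightarrow> 'k::field \<Rightarrow> 'k^4^4" where
  "E4 i j c = (\<chi> r s. if r = i \<and> s = j then c else 0)"

text \<open>The alternating form in a symplectic basis \<open>e\<^sub>1, e\<^sub>2, f\<^sub>1, f\<^sub>2\<close>.\<close>

definition J4 :: "'k::field^4^4" where
  "J4 = E4 1 3 1 + E4 2 4 1 + E4 3 1 (-1) + E4 4 2 (-1)"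

definition Sp4 :: "('k::field^4^4) monoid" where
  "Sp4 = \<lparr>carrier = {A. transpose A ** J4 ** A = J4}, mult = (**), one = mat 1\<rparr>"

definition group_center :: "('a, 'm) monoid_scheme \<Rightarrow> 'a set" where
  "group_center G = {z \<in> carrier G. \<forall>g\<in>carrier G. z \<otimes>\<^bsub>G\<^esub> g = g \<otimes>\<^bsub>G\<^esub> z}"

definition PSp4 :: "('k::field^4^4) set monoid" where
  "PSp4 = Sp4 Mod group_center Sp4"

text \<open>
  The root system of type \<open>C\<^sub>2\<close>: \<open>R1 = \<epsilon>\<^sub>1 - \<epsilon>\<^sub>2\<close> and \<open>R3 = \<epsilon>\<^sub>1 + \<epsilon>\<^sub>2\<close> are the positive short roots,
  \<open>R2 = 2\<epsilon>\<^sub>1\<close> and \<open>R4 = 2\<epsilon>\<^sub>2\<close> the positive long roots, and \<open>Ni = - Ri\<close>. The simple roots are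
  \<open>R1\<close> and \<open>R4\<close>.
\<close>

datatype c2_root = R1 | R2 | R3 | R4 | N1 | N2 | N3 | N4

definition short_roots :: "c2_root set" where
  "short_roots = {R1, R3, N1, N3}"

definition positive_roots :: "c2_root set" where
  "positive_roots = {R1, R2, R3, R4}"

fun root_mat :: "c2_root \<Rightarrow> 'k::field \<Rightarrow> 'k^4^4" where
  "root_mat R1 c = mat 1 + E4 1 2 c + E4 4 3 (-c)"
| "root_mat R2 c = mat 1 + E4 1 3 c"
| "root_mat R3 c = mat 1 + E4 1 4 c + E4 2 3 c"
| "root_mat R4 c = mat 1 + E4 2 4 c"
| "root_mat N1 c = mat 1 + E4 2 1 c + E4 3 4 (-c)"
| "root_mat N2 c = mat 1 + E4 3 1 c"
| "root_mat N3 c = mat 1 + E4 4 1 c + E4 3 2 c"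
| "root_mat N4 c = mat 1 + E4 4 2 c"

definition root_elt :: "c2_root \<Rightarrow> 'k::field \<Rightarrow> ('k^4^4) set" where
  "root_elt \<gamma> c = group_center Sp4 #>\<^bsub>Sp4\<^esub> root_mat \<gamma> c"

definition root_subgrp :: "'k::field set \<Rightarrow> 'k set \<Rightarrow> c2_root \<Rightarrow> ('k^4^4) set set" where
  "root_subgrp K0 L0 \<gamma> = root_elt \<gamma> ` (if \<gamma> \<in> short_roots then K0 else L0)"

definition PSp4_sub :: "'k::field set \<Rightarrow> 'k set \<Rightarrow> ('k^4^4) set monoid" where
  "PSp4_sub L0 K0 = PSp4\<lparr>carrier := generate PSp4 (\<Union>\<gamma>. root_subgrp K0 L0 \<gamma>)\<rparr>"

definition U_group :: "'k::field set \<Rightarrow> 'k set \<Rightarrow> ('k^4^4) set monoid" where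
  "U_group L0 K0 = (PSp4_sub L0 K0)
     \<lparr>carrier := generate (PSp4_sub L0 K0) (\<Union>\<gamma>\<in>positive_roots. root_subgrp K0 L0 \<gamma>)\<rparr>"

text \<open>
  The matrices \<open>x\<^sub>i(c) = root_mat Ri c\<close> are symplectic and satisfy the commutator relations
  \<open>[x\<^sub>1(t), x\<^sub>4(a)] = x\<^sub>2(t\<^sup>2a) x\<^sub>3(ta)\<close> (written as \<open>xy = [x, y] yx\<close>), the other pairs commuting;
  characteristic two is needed only for \<open>x\<^sub>1\<close> and \<open>x\<^sub>3\<close> to commute.
\<close>

lemmas mat4_simps = vec_eq_iff matrix_matrix_mult_def transpose_def mat_def E4_def J4_def
  forall_4 sum_4

lemma root_mat_in_Sp4: "root_mat \<gamma> c \<in> carrier Sp4"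
  by (cases \<gamma>) (simp_all add: Sp4_def mat4_simps)

lemma root_mat_add: "root_mat \<gamma> s ** root_mat \<gamma> t = root_mat \<gamma> (s + t)"
  by (cases \<gamma>) (simp_all add: mat4_simps)

lemma root_mat_commutator:
  "root_mat R1 t ** root_mat R4 a =
     root_mat R2 (t\<^sup>2 * a) ** root_mat R3 (t * a) ** root_mat R4 a ** root_mat R1 t"
  by (simp add: mat4_simps power2_eq_square algebra_simps)

lemma root_mat_commute:
  "root_mat R1 s ** root_mat R2 t = root_mat R2 t ** root_mat R1 s"
  "root_mat R2 s ** root_mat R3 t = root_mat R3 t ** root_mat R2 s"
  "root_mat R2 s ** root_mat R4 t = root_mat R4 t ** root_mat R2 s"
  "root_mat R3 s ** root_mat R4 t = root_mat R4 t ** root_mat R3 s"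
  by (simp_all add: mat4_simps algebra_simps)

lemma root_mat_commute_1_3:
  assumes "CHAR('k::field) = 2"
  shows "root_mat R1 (s::'k) ** root_mat R3 t = root_mat R3 t ** root_mat R1 s"
proof -
  have "(2::'k) = 0"
    by (metis assms of_nat_CHAR of_nat_numeral)
  then have "x + x = 0" for x :: 'k
    by (metis mult_2 mult_zero_left)
  then have "- x = x" for x :: 'k
    by (simp add: minus_unique)
  then show ?thesis
    by (simp add: mat4_simps algebra_simps)
qed

end

theory Submission
  imports Defs
begin

text \<open>
  In characteristic two the centre of \<open>Sp\<^sub>4\<close> is trivial, so \<open>U\<close> consists of the elements
  \<open>u t b s a = x\<^sub>2(b) x\<^sub>3(s) x\<^sub>4(a) x\<^sub>1(t)\<close>, and its multiplication only involves addition and the products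
  \<open>t\<^sup>2 a\<close> and \<open>t a\<close> with \<open>a \<in> L\<^sub>0\<close>; the latter is definable from \<open>*\<close> since squaring is injective.

  Conversely, interpret \<open>K\<^sub>0\<close> on \<open>U\<close> by the coordinate \<open>t\<close>. Let \<open>B = U\<^sub>2 U\<^sub>3 U\<^sub>4\<close> be the centralizer of
  \<open>x\<^sub>4(1)\<close>. The axioms of a weak indifferent set imply that the commutators \<open>[g, v]\<close> with \<open>v \<in> B\<close> are
  exactly \<open>1\<close> and the \<open>x\<^sub>2(x) x\<^sub>3(y)\<close> with \<open>x\<close> and \<open>y\<close> both nonzero. Hence \<open>U\<^sub>2 \<union> U\<^sub>3\<close> is definable in the
  centre \<open>U\<^sub>2 U\<^sub>3\<close>, and \<open>z\<close> is in \<open>U\<^sub>2\<close> iff \<open>z\<close> and \<open>z x\<^sub>2(1)\<close> are in \<open>U\<^sub>2 \<union> U\<^sub>3\<close>; similarly for \<open>U\<^sub>3\<close>. For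
  \<open>v = x\<^sub>4(a)\<close> modulo the centre, the product of \<open>[x\<^sub>1(t), x\<^sub>4(1)] = x\<^sub>2(t\<^sup>2) x\<^sub>3(t)\<close> and
  \<open>[x\<^sub>1(1), v] = x\<^sub>2(a) x\<^sub>3(a)\<close> lies in \<open>U\<^sub>2\<close> iff \<open>a = t\<close> and in \<open>U\<^sub>3\<close> iff \<open>a = t\<^sup>2\<close>, which defines \<open>L\<^sub>0\<close> and
  squaring, while \<open>[x\<^sub>1(t), v]\<close> gives the product \<open>t a\<close>.
\<close>

section \<open>The symplectic group\<close>

lemma Sp4_group: "group (Sp4 :: ('k::field^4^4) monoid)"
proof (rule groupI)
  have JJ: "(- J4) ** J4 = (mat 1 :: 'k^4^4)"
    by (simp add: mat4_simps)
  fix A :: "'k^4^4"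
  assume A: "A \<in> carrier Sp4"
  then have symp: "transpose A ** J4 ** A = J4"
    by (simp add: Sp4_def)
  \<comment> \<open>Since (-J)J = 1, the equation A^T J A = J makes (-J) A^T J a left inverse of A.
    For square matrices it is then also a right inverse, which is what shows that B is
    symplectic.\<close>
  define B where "B = (- J4) ** transpose A ** J4"
  have BA: "B ** A = mat 1"
    by (metis B_def JJ matrix_mul_assoc symp)
  then have AB: "A ** B = mat 1"
    by (simp add: matrix_left_right_inverse)
  have "transpose B ** J4 ** B = transpose B ** (transpose A ** J4 ** A) ** B"
    by (simp add: symp)
  also have "\<dots> = transpose (A ** B) ** J4 ** (A ** B)"
    by (simp add: matrix_transpose_mul matrix_mul_assoc)
  finally have "transpose B ** J4 ** B = J4"
    by (simp add: AB transpose_mat)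
  with BA show "\<exists>B\<in>carrier Sp4. B \<otimes>\<^bsub>Sp4\<^esub> A = \<one>\<^bsub>Sp4\<^esub>"
    by (auto simp: Sp4_def)
next
  fix A B :: "'k^4^4"
  assume "A \<in> carrier Sp4" "B \<in> carrier Sp4"
  then have "transpose A ** J4 ** A = J4" "transpose B ** J4 ** B = J4"
    by (simp_all add: Sp4_def)
  moreover have "transpose (A ** B) ** J4 ** (A ** B) = transpose B ** (transpose A ** J4 ** A) ** B"
    by (simp add: matrix_transpose_mul matrix_mul_assoc)
  ultimately have "transpose (A ** B) ** J4 ** (A ** B) = J4"
    by simp
  then show "A \<otimes>\<^bsub>Sp4\<^esub> B \<in> carrier Sp4"
    by (simp add: Sp4_def)
qed (simp_all add: Sp4_def matrix_mul_assoc transpose_mat)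

section \<open>Definable sets of tuples and the formulas for the group\<close>

lemma definableI:
  assumes "wf_fm M p" "range e \<subseteq> universe M" "X \<subseteq> tuples (universe M) n"
    and "\<And>xs. xs \<in> tuples (universe M) n \<Longrightarrow> xs \<in> X \<longleftrightarrow> sat M (\<lambda>i. if i < n then xs ! i else e i) p"
  shows "definable M n X"
  using assms unfolding definable_def by blast

lemma tuples_0 [simp]: "tuples A 0 = {[]}"
  by (auto simp: tuples_def)

lemma in_tuples_Suc: "xs \<in> tuples A (Suc n) \<longleftrightarrow> (\<exists>x\<in>A. \<exists>ys\<in>tuples A n. xs = x # ys)"
  by (auto simp: tuples_def length_Suc_conv)

lemma in_tuples_numeral:
  "xs \<in> tuples A (numeral n) \<longleftrightarrow> (\<exists>x\<in>A. \<exists>ys\<in>tuples A (pred_numeral n). xs = x # ys)"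
  by (simp add: numeral_eq_Suc in_tuples_Suc)

text \<open>Brings the clause of \<open>interprets_via\<close> for a unary function symbol, such as
  \<open>Inv\<close>, into the form of a set of pairs.\<close>

lemma tuples_1_graph:
  "{concat xss @ ys | xss ys. xss \<in> tuples D 1 \<and> ys \<in> E \<and> P xss ys} =
     {xs @ ys | xs ys. xs \<in> D \<and> ys \<in> E \<and> P [xs] ys}"
proof -
  have "tuples D 1 = {[xs] | xs. xs \<in> D}"
    by (auto simp: in_tuples_Suc)
  moreover have "xs @ ys \<in> {concat xss @ ys | xss ys. xss \<in> {[xs] | xs. xs \<in> D} \<and> ys \<in> E \<and> P xss ys}"
    if "xs \<in> D" "ys \<in> E" "P [xs] ys" for xs ys
    using that by (intro CollectI exI[of _ "[xs]"] exI[of _ ys]) simp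
  ultimately show ?thesis
    by auto
qed

definition plus_t :: "indiff_fun trm \<Rightarrow> indiff_fun trm \<Rightarrow> indiff_fun trm" where
  "plus_t s t = Fn Plus [s, t]"

definition star_t :: "indiff_fun trm \<Rightarrow> indiff_fun trm \<Rightarrow> indiff_fun trm" where
  "star_t s t = Fn Star [s, t]"

definition L0_fm :: "nat \<Rightarrow> (indiff_fun, indiff_rel) fm" where
  "L0_fm i = Rl InL0 [Var i]"

definition mult_t :: "group_sym trm \<Rightarrow> group_sym trm \<Rightarrow> group_sym trm" where
  "mult_t s t = Fn Mult [s, t]"

definition one_t :: "group_sym trm" where
  "one_t = Fn Unit []"

text \<open>Follows the convention xy = [x, y] yx, so that [x, y] = xy(yx)^{-1} needs a single
  inverse.\<close>

definition comm_t :: "group_sym trm \<Rightarrow> group_sym trm \<Rightarrow> group_sym trm" where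
  "comm_t s t = mult_t (mult_t s t) (Fn Inv [mult_t t s])"

text \<open>
  In the formulas for the group, the variables \<open>10, 11, 12, 13\<close> are the parameters \<open>x\<^sub>i(1)\<close> for
  \<open>i = 1, 2, 3, 4\<close>. Since the variables \<open>20\<close> and \<open>21\<close> are bound below, they may not occur in \<open>z\<close>.
\<close>

definition in_B :: "nat \<Rightarrow> (group_sym, unit) fm" where
  "in_B i = Eq (comm_t (Var i) (Var 13)) one_t"

definition in_U2_Un_U3 :: "group_sym trm \<Rightarrow> (group_sym, unit) fm" where
  "in_U2_Un_U3 z = Neg (Conj (Neg (Eq z one_t))
     (Ex 20 (Ex 21 (Conj (in_B 21) (Eq (comm_t (Var 20) (Var 21)) z)))))"

definition in_U2 :: "group_sym trm \<Rightarrow> (group_sym, unit) fm" where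
  "in_U2 z = Conj (in_U2_Un_U3 z) (in_U2_Un_U3 (mult_t z (Var 11)))"

definition in_U3 :: "group_sym trm \<Rightarrow> (group_sym, unit) fm" where
  "in_U3 z = Conj (in_U2_Un_U3 z) (in_U2_Un_U3 (mult_t z (Var 12)))"

section \<open>Arithmetic in a weak indifferent set\<close>

locale weak_indifferent =
  fixes K0 L0 :: "'k::field set"
  assumes weak_indifferent: "weak_indifferent_set K0 L0"
begin

lemma two_zero [simp]: "(2::'k) = 0"
  using weak_indifferent unfolding weak_indifferent_set_def by (metis of_nat_CHAR of_nat_numeral)

lemma add_self [simp]: "x + x = (0::'k)"
  by (metis mult_2 mult_zero_left two_zero)

lemma add_self_left [simp]: "x + (x + y) = (y::'k)"
  by (simp flip: add.assoc)

lemma uminus_id [simp]: "- x = (x::'k)"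
  by (simp add: minus_unique)

lemma diff_is_add [simp]: "x - y = (x::'k) + y"
  by (simp add: diff_conv_add_uminus del: add_uminus_conv_diff)

lemma add_eq_zero_iff [simp]: "x + y = 0 \<longleftrightarrow> x = (y::'k)"
  by (metis uminus_id add_eq_0_iff2)

lemma square_inject [simp]: "x\<^sup>2 = y\<^sup>2 \<longleftrightarrow> x = (y::'k)"
  by (simp add: power2_eq_iff)

lemma K0_zero [simp]: "0 \<in> K0" and L0_zero [simp]: "0 \<in> L0"
  and L0_square [simp]: "x\<^sup>2 \<in> L0"
  and L0_K0: "a \<in> L0 \<Longrightarrow> a \<in> K0"
  using weak_indifferent by (auto simp: weak_indifferent_set_def additive_subgrp_def)

lemma K0_add [simp]: "x \<in> K0 \<Longrightarrow> y \<in> K0 \<Longrightarrow> x + y \<in> K0"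
  and L0_add [simp]: "a \<in> L0 \<Longrightarrow> b \<in> L0 \<Longrightarrow> a + b \<in> L0"
  using weak_indifferent unfolding weak_indifferent_set_def additive_subgrp_def diff_is_add by blast+

lemma L0_one [simp]: "1 \<in> L0"
  using L0_square[of 1] by simp

lemma K0_one [simp]: "1 \<in> K0"
  by (simp add: L0_K0)

text \<open>The two subfields enter the proof only through their generators: squares of elements of
  \<open>K0\<close> here, elements of \<open>L0\<close> in the next lemma.\<close>

lemma K0_square_mult [simp]: "t \<in> K0 \<Longrightarrow> a \<in> L0 \<Longrightarrow> t\<^sup>2 * a \<in> L0"
  using weak_indifferent unfolding weak_indifferent_set_def by (metis hull_inc image_eqI)

lemma K0_mult_L0 [simp]: "t \<in> K0 \<Longrightarrow> a \<in> L0 \<Longrightarrow> t * a \<in> K0"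
  using weak_indifferent unfolding weak_indifferent_set_def by (metis hull_inc mult.commute)

text \<open>\<open>L0\<close> contains every square of K, in particular the square of 1/t. As
  \<open>K0\<close> absorbs factors from \<open>L0\<close>, rewriting 1/t as t(1/t)^2
  suffices.\<close>

lemma L0_divide_K0:
  assumes "a \<in> L0" "t \<in> K0" "t \<noteq> 0"
  shows "a / t \<in> K0"
proof -
  have "a / t = (t * (inverse t)\<^sup>2) * a"
    using assms by (simp add: field_simps power2_eq_square)
  then show ?thesis
    using assms by simp
qed

text \<open>Here 1/a is in \<open>K0\<close> because 1 is in \<open>L0\<close>. Rewriting 1/a as
  (1/a)^2 a leaves an element of \<open>L0\<close> multiplied by squares from \<open>K0\<close>, and
  \<open>L0\<close> absorbs these.\<close>

lemma K0_square_divide_L0: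
  assumes "a \<in> L0" "t \<in> K0" "a \<noteq> 0"
  shows "t\<^sup>2 / a \<in> L0"
proof -
  have "1 / a \<in> K0"
    using assms by (intro L0_divide_K0) (auto simp: L0_K0)
  then have "t\<^sup>2 * ((1 / a)\<^sup>2 * a) \<in> L0"
    using assms by simp
  moreover have "t\<^sup>2 / a = t\<^sup>2 * ((1 / a)\<^sup>2 * a)"
    using assms by (simp add: field_simps power2_eq_square)
  ultimately show ?thesis by simp
qed

section \<open>The projective group in characteristic two\<close>

lemma Sp4_center: "group_center (Sp4 :: ('k^4^4) monoid) = {mat 1}"
proof -
  have "z = mat 1" if "z \<in> group_center Sp4" for z :: "'k^4^4"
  proof -
    have comm: "z ** root_mat \<gamma> 1 = root_mat \<gamma> 1 ** z" for \<gamma>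
      using that root_mat_in_Sp4[of \<gamma> 1] by (auto simp: group_center_def Sp4_def)
    have symp: "transpose z ** J4 ** z = J4"
      using that by (auto simp: group_center_def Sp4_def)
    \<comment> \<open>The four long root elements make z diagonal with paired entries equal. The
      short root \<open>R1\<close> then makes z scalar, and the form gives the scalar square 1,
      hence the value 1 because squaring is injective.\<close>
    have diag: "z$1$2 = 0" "z$1$3 = 0" "z$1$4 = 0" "z$2$1 = 0" "z$2$3 = 0" "z$2$4 = 0"
      "z$3$1 = 0" "z$3$2 = 0" "z$3$4 = 0" "z$4$1 = 0" "z$4$2 = 0" "z$4$3 = 0"
      "z$3$3 = z$1$1" "z$4$4 = z$2$2"
      using comm[of R2] comm[of R4] comm[of N2] comm[of N4] by (simp_all add: mat4_simps)
    moreover have "z$2$2 = z$1$1"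
      using arg_cong[OF comm[of R1], of "\<lambda>A. A$1$2"] by (simp add: mat4_simps diag)
    moreover have "(z$1$1)\<^sup>2 = 1\<^sup>2"
      using arg_cong[OF symp, of "\<lambda>A. A$1$3"] by (simp add: mat4_simps power2_eq_square diag)
    ultimately show ?thesis
      unfolding square_inject by (simp add: mat4_simps)
  qed
  then show ?thesis
    by (auto simp: group_center_def Sp4_def transpose_mat)
qed

text \<open>With a trivial centre, computing with cosets reduces to computing with matrices inside
  singletons.\<close>

lemma center_coset: "group_center Sp4 #>\<^bsub>Sp4\<^esub> (A :: 'k^4^4) = {A}"
  unfolding Sp4_center r_coset_def by (simp add: Sp4_def)

lemma PSp4_mult: "{A} \<otimes>\<^bsub>PSp4\<^esub> {B} = {A ** (B :: 'k^4^4)}"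
  by (simp add: PSp4_def FactGroup_def set_mult_def Sp4_def)

lemma PSp4_one: "\<one>\<^bsub>PSp4\<^esub> = {mat 1 :: 'k^4^4}"
  by (simp add: PSp4_def FactGroup_def Sp4_center)

lemma PSp4_carrier: "A \<in> carrier Sp4 \<Longrightarrow> {A :: 'k^4^4} \<in> carrier PSp4"
  by (auto simp: PSp4_def FactGroup_def RCOSETS_def center_coset)

lemma root_elt_eq: "root_elt \<gamma> (c :: 'k) = {root_mat \<gamma> c}"
  by (simp add: root_elt_def center_coset)

lemma PSp4_group: "group (PSp4 :: ('k^4^4) set monoid)"
proof -
  interpret Sp4: group "Sp4 :: ('k^4^4) monoid"
    by (rule Sp4_group)
  have "mat 1 = \<one>\<^bsub>(Sp4 :: ('k^4^4) monoid)\<^esub>"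
    by (simp add: Sp4_def)
  then have "group_center (Sp4 :: ('k^4^4) monoid) \<lhd> Sp4"
    by (metis Sp4_center Sp4.one_is_normal)
  then show ?thesis
    unfolding PSp4_def by (rule normal.factorgroup_is_group)
qed

section \<open>Coordinates on U\<close>

definition umat :: "'k \<Rightarrow> 'k \<Rightarrow> 'k \<Rightarrow> 'k \<Rightarrow> 'k^4^4" where
  "umat t b s a = mat 1 + E4 1 2 t + E4 4 3 t + E4 1 3 (b + s * t) + E4 1 4 s + E4 2 3 (s + a * t) + E4 2 4 a"

text \<open>Characteristic two allows the signs to be dropped in \<open>umat\<close>. Its explicit
  entries let uniqueness of the coordinates be read off.\<close>

lemma umat_eq: "umat t b s a = root_mat R2 b ** root_mat R3 s ** root_mat R4 a ** root_mat R1 t"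
  by (simp add: umat_def mat4_simps)

text \<open>The cross terms come from moving x_1(t) past x_4(a'), which produces x_2(t^2 a')
  x_3(ta'); all other root elements commute.\<close>

lemma umat_mult:
  "umat t b s a ** umat t' b' s' a' = umat (t + t') (b + b' + t\<^sup>2 * a') (s + s' + t * a') (a + a')"
  by (simp add: umat_def mat4_simps algebra_simps power2_eq_square)

lemma umat_inject: "umat t b s a = umat t' b' s' a' \<longleftrightarrow> t = t' \<and> b = b' \<and> s = s' \<and> a = a'"
  by (auto simp: umat_def mat4_simps)

lemma umat_one: "umat 0 0 0 0 = mat 1"
  by (simp add: umat_def mat4_simps)

lemma root_mat_umat:
  "root_mat R1 c = umat c 0 0 0" "root_mat R2 c = umat 0 c 0 0"
  "root_mat R3 c = umat 0 0 c 0" "root_mat R4 c = umat 0 0 0 c"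
  by (simp_all add: umat_def mat4_simps)

lemma umat_entry_1_2: "umat t b s a $ 1 $ 2 = t"
  by (simp add: umat_def mat4_simps)

lemma umat_in_Sp4: "umat t b s a \<in> carrier Sp4"
proof -
  interpret Sp4: group "Sp4 :: ('k^4^4) monoid"
    by (rule Sp4_group)
  have "A \<in> carrier Sp4 \<Longrightarrow> B \<in> carrier Sp4 \<Longrightarrow> A ** B \<in> carrier Sp4" for A B :: "'k^4^4"
    using Sp4.m_closed[of A B] by (simp add: Sp4_def)
  then show ?thesis
    by (simp only: umat_eq root_mat_in_Sp4)
qed

definition u :: "'k \<Rightarrow> 'k \<Rightarrow> 'k \<Rightarrow> 'k \<Rightarrow> ('k^4^4) set" where
  "u t b s a = {umat t b s a}"

lemma u_inject [simp]: "u t b s a = u t' b' s' a' \<longleftrightarrow> t = t' \<and> b = b' \<and> s = s' \<and> a = a'"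
  by (simp add: u_def umat_inject)

lemma u_in_PSp4: "u t b s a \<in> carrier PSp4"
  by (simp add: u_def PSp4_carrier umat_in_Sp4)

lemma PSp4_u_mult:
  "u t b s a \<otimes>\<^bsub>PSp4\<^esub> u t' b' s' a' = u (t + t') (b + b' + t\<^sup>2 * a') (s + s' + t * a') (a + a')"
  by (simp add: u_def PSp4_mult umat_mult)

lemma PSp4_u_one: "\<one>\<^bsub>PSp4\<^esub> = u 0 0 0 0"
  by (simp add: u_def PSp4_one umat_one)

lemma PSp4_u_inv: "inv\<^bsub>PSp4\<^esub> u t b s a = u t (b + t\<^sup>2 * a) (s + t * a) a"
  by (rule group.inv_equality[OF PSp4_group])
    (simp_all add: PSp4_u_mult PSp4_u_one u_in_PSp4 add_ac)

definition U_set :: "('k^4^4) set set" where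
  "U_set = {u t b s a | t b s a. t \<in> K0 \<and> b \<in> L0 \<and> s \<in> K0 \<and> a \<in> L0}"

lemma U_set_subgroup: "subgroup U_set PSp4"
proof (rule group.subgroupI[OF PSp4_group])
  show "U_set \<subseteq> carrier PSp4"
    by (auto simp: U_set_def u_in_PSp4)
  have "u 0 0 0 0 \<in> U_set"
    using K0_zero L0_zero unfolding U_set_def by blast
  then show "U_set \<noteq> {}"
    by blast
  show "inv\<^bsub>PSp4\<^esub> x \<in> U_set" if "x \<in> U_set" for x
    using that by (auto simp: U_set_def PSp4_u_inv)
  show "x \<otimes>\<^bsub>PSp4\<^esub> y \<in> U_set" if "x \<in> U_set" "y \<in> U_set" for x y
    using that by (auto simp: U_set_def PSp4_u_mult)
qed

lemma root_elt_u:
  "root_elt R1 c = u c 0 0 0" "root_elt R2 c = u 0 c 0 0"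
  "root_elt R3 c = u 0 0 c 0" "root_elt R4 c = u 0 0 0 c"
  by (simp_all add: root_elt_eq u_def root_mat_umat del: root_mat.simps)

lemma positive_root_subgrps:
  "(\<Union>\<gamma>\<in>positive_roots. root_subgrp K0 L0 \<gamma>) =
     (\<lambda>c. u c 0 0 0) ` K0 \<union> (\<lambda>c. u 0 c 0 0) ` L0 \<union> (\<lambda>c. u 0 0 c 0) ` K0 \<union> (\<lambda>c. u 0 0 0 c) ` L0"
  by (auto simp: positive_roots_def root_subgrp_def short_roots_def root_elt_u)

lemma generate_positive_root_subgrps:
  "generate PSp4 (\<Union>\<gamma>\<in>positive_roots. root_subgrp K0 L0 \<gamma>) = U_set" (is "generate PSp4 ?R = _")
proof
  have "?R \<subseteq> U_set"
    unfolding positive_root_subgrps U_set_def by auto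
  then show "generate PSp4 ?R \<subseteq> U_set"
    by (rule group.generate_subgroup_incl[OF PSp4_group _ U_set_subgroup])
  show "U_set \<subseteq> generate PSp4 ?R"
  proof
    fix g assume "g \<in> U_set"
    then obtain t b s a where g: "g = u t b s a" and mem: "t \<in> K0" "b \<in> L0" "s \<in> K0" "a \<in> L0"
      by (auto simp: U_set_def)
    have "g = u 0 b 0 0 \<otimes>\<^bsub>PSp4\<^esub> u 0 0 s 0 \<otimes>\<^bsub>PSp4\<^esub> u 0 0 0 a \<otimes>\<^bsub>PSp4\<^esub> u t 0 0 0"
      by (simp add: g PSp4_u_mult)
    also have "\<dots> \<in> generate PSp4 ?R"
      unfolding positive_root_subgrps using mem by (intro generate.eng generate.incl) auto
    finally show "g \<in> generate PSp4 ?R" .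
  qed
qed

abbreviation G :: "('k^4^4) set monoid" where
  "G \<equiv> U_group L0 K0"

text \<open>\<open>U_group\<close> is generated inside \<open>PSp4_sub\<close>. The positive root
  subgroups lie there, so generating inside \<open>PSp4\<close> gives the same set.\<close>

lemma U_group_eq: "G = PSp4\<lparr>carrier := U_set\<rparr>"
proof -
  let ?S = "generate PSp4 (\<Union>\<gamma>. root_subgrp K0 L0 \<gamma>)"
  interpret PSp4: group "PSp4 :: ('k^4^4) set monoid"
    by (rule PSp4_group)
  have "root_elt \<gamma> c \<in> carrier PSp4" for \<gamma> and c :: 'k
    by (simp add: root_elt_eq PSp4_carrier root_mat_in_Sp4)
  then have "subgroup ?S PSp4"
    by (intro PSp4.generate_is_subgroup) (auto simp: root_subgrp_def)
  moreover have "(\<Union>\<gamma>\<in>positive_roots. root_subgrp K0 L0 \<gamma>) \<subseteq> ?S"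
    by (auto intro: generate.incl)
  ultimately show ?thesis
    by (simp add: U_group_def PSp4_sub_def PSp4.generate_consistent generate_positive_root_subgrps)
qed

lemma carrier_G: "carrier G = {u t b s a | t b s a. t \<in> K0 \<and> b \<in> L0 \<and> s \<in> K0 \<and> a \<in> L0}"
  by (simp add: U_group_eq U_set_def)

lemma u_mult [simp]:
  "u t b s a \<otimes>\<^bsub>G\<^esub> u t' b' s' a' = u (t + t') (b + b' + t\<^sup>2 * a') (s + s' + t * a') (a + a')"
  by (simp add: U_group_eq PSp4_u_mult)

lemma u_one [simp]: "\<one>\<^bsub>G\<^esub> = u 0 0 0 0"
  by (simp add: U_group_eq PSp4_u_one)

lemma u_in_carrier [simp]: "u t b s a \<in> carrier G \<longleftrightarrow> t \<in> K0 \<and> b \<in> L0 \<and> s \<in> K0 \<and> a \<in> L0"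
  by (auto simp: carrier_G)

lemma u_inv [simp]:
  assumes "t \<in> K0" "b \<in> L0" "s \<in> K0" "a \<in> L0"
  shows "inv\<^bsub>G\<^esub> u t b s a = u t (b + t\<^sup>2 * a) (s + t * a) a"
proof -
  have "group G"
    unfolding U_group_eq by (rule group.subgroup_imp_group[OF PSp4_group U_set_subgroup])
  then show ?thesis
    by (rule group.inv_equality) (use assms in \<open>simp_all add: add_ac\<close>)
qed

lemma bex_carrier_G:
  "(\<exists>g\<in>carrier G. P g) \<longleftrightarrow> (\<exists>t\<in>K0. \<exists>b\<in>L0. \<exists>s\<in>K0. \<exists>a\<in>L0. P (u t b s a))"
  unfolding carrier_G by blast

subsection \<open>The group in the indifferent set\<close>

abbreviation M :: "(indiff_fun, indiff_rel, 'k) fo_structure" where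
  "M \<equiv> indiff_structure K0 L0"

definition D4 :: "'k list set" where
  "D4 = {[t, b, s, a] | t b s a. t \<in> K0 \<and> b \<in> L0 \<and> s \<in> K0 \<and> a \<in> L0}"

definition h4 :: "'k list \<Rightarrow> ('k^4^4) set" where
  "h4 xs = u (xs ! 0) (xs ! 1) (xs ! 2) (xs ! 3)"

text \<open>A triple of elements of U occupies the variables 0 to 11, so the parameters start at 12.
  Variable 12 names 1, as \<open>affine_fm\<close> requires, and 13 names 0.\<close>

definition e4 :: "nat \<Rightarrow> 'k" where
  "e4 i = (if i = 13 then 0 else 1)"

lemma e4_in_K0 [simp]: "e4 i \<in> K0"
  by (simp add: e4_def)

lemma M_simps [simp]:
  "universe M = K0"
  "trm_val M e (plus_t p q) = trm_val M e p + trm_val M e q"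
  "trm_val M e (star_t p q) = (trm_val M e p)\<^sup>2 * trm_val M e q"
  "sat M e (L0_fm i) \<longleftrightarrow> e i \<in> L0"
  "wf_trm M (plus_t p q) \<longleftrightarrow> wf_trm M p \<and> wf_trm M q"
  "wf_trm M (star_t p q) \<longleftrightarrow> wf_trm M p \<and> wf_trm M q"
  "wf_fm M (L0_fm i)"
  by (simp_all add: indiff_structure_def plus_t_def star_t_def L0_fm_def)

lemma in_D4 [simp]: "[t, b, s, a] \<in> D4 \<longleftrightarrow> t \<in> K0 \<and> b \<in> L0 \<and> s \<in> K0 \<and> a \<in> L0"
  by (auto simp: D4_def)

lemma h4_simp [simp]: "h4 [t, b, s, a] = u t b s a"
  by (simp add: h4_def)

lemma h4_image: "h4 ` D4 = carrier G"
proof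
  show "h4 ` D4 \<subseteq> carrier G"
    by (auto simp: D4_def)
  show "carrier G \<subseteq> h4 ` D4"
  proof
    fix g assume "g \<in> carrier G"
    then obtain t b s a where "g = h4 [t, b, s, a]" "[t, b, s, a] \<in> D4"
      by (auto simp: carrier_G)
    then show "g \<in> h4 ` D4"
      by blast
  qed
qed

text \<open>
  For \<open>a \<in> L\<^sub>0\<close> the product \<open>t a\<close> is definable, because squaring is injective and
  \<open>t\<^sup>2 a\<^sup>2 = t * (a * 1)\<close>.
\<close>

definition affine_fm ::
  "indiff_fun trm \<Rightarrow> indiff_fun trm \<Rightarrow> indiff_fun trm \<Rightarrow> indiff_fun trm \<Rightarrow> (indiff_fun, indiff_rel) fm" where
  "affine_fm d t a c = Eq (star_t (plus_t c d) (Var 12)) (star_t t (star_t a (Var 12)))"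

lemma wf_affine_fm [simp]:
  "wf_fm M (affine_fm d t a c) \<longleftrightarrow> wf_trm M d \<and> wf_trm M t \<and> wf_trm M a \<and> wf_trm M c"
  by (auto simp: affine_fm_def)

lemma sat_affine_fm [simp]:
  assumes "e 12 = 1"
  shows "sat M e (affine_fm d t a c) \<longleftrightarrow> trm_val M e d + trm_val M e t * trm_val M e a = trm_val M e c"
proof -
  \<comment> \<open>In characteristic two d changes sides without a sign: the formula itself
    compares c + d with ta.\<close>
  have "x + y = z \<longleftrightarrow> y + z = x" for x y z :: 'k
    by (auto simp: add_ac)
  with assms show ?thesis
    by (simp add: affine_fm_def flip: power_mult_distrib)
qed

text \<open>Keeping P abstract allows one membership rule for explicit lists, so that concatenations
  need not be split anew for each symbol.\<close>

definition D4_pairs :: "('k list \<Rightarrow> 'k list \<Rightarrow> bool) \<Rightarrow> 'k list set" where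
  "D4_pairs P = {xs @ ys | xs ys. xs \<in> D4 \<and> ys \<in> D4 \<and> P xs ys}"

definition D4_triples :: "('k list list \<Rightarrow> 'k list \<Rightarrow> bool) \<Rightarrow> 'k list set" where
  "D4_triples P = {concat xss @ zs | xss zs. xss \<in> tuples D4 2 \<and> zs \<in> D4 \<and> P xss zs}"

lemma in_D4_pairs:
  "[x0, x1, x2, x3, y0, y1, y2, y3] \<in> D4_pairs P \<longleftrightarrow>
     [x0, x1, x2, x3] \<in> D4 \<and> [y0, y1, y2, y3] \<in> D4 \<and> P [x0, x1, x2, x3] [y0, y1, y2, y3]"
proof -
  have "P [x0, x1, x2, x3] [y0, y1, y2, y3] \<Longrightarrow> [x0, x1, x2, x3] \<in> D4 \<Longrightarrow> [y0, y1, y2, y3] \<in> D4 \<Longrightarrow>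
    \<exists>xs ys. [x0, x1, x2, x3, y0, y1, y2, y3] = xs @ ys \<and> xs \<in> D4 \<and> ys \<in> D4 \<and> P xs ys"
    by (intro exI[of _ "[x0, x1, x2, x3]"] exI[of _ "[y0, y1, y2, y3]"]) simp
  then show ?thesis
    by (auto simp: D4_pairs_def D4_def)
qed

lemma in_D4_triples:
  "[x0, x1, x2, x3, y0, y1, y2, y3, z0, z1, z2, z3] \<in> D4_triples P \<longleftrightarrow>
     [x0, x1, x2, x3] \<in> D4 \<and> [y0, y1, y2, y3] \<in> D4 \<and> [z0, z1, z2, z3] \<in> D4 \<and>
     P [[x0, x1, x2, x3], [y0, y1, y2, y3]] [z0, z1, z2, z3]"
proof -
  have "P [[x0, x1, x2, x3], [y0, y1, y2, y3]] [z0, z1, z2, z3] \<Longrightarrow>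
    [x0, x1, x2, x3] \<in> D4 \<Longrightarrow> [y0, y1, y2, y3] \<in> D4 \<Longrightarrow> [z0, z1, z2, z3] \<in> D4 \<Longrightarrow>
    \<exists>xss zs. [x0, x1, x2, x3, y0, y1, y2, y3, z0, z1, z2, z3] = concat xss @ zs \<and>
      xss \<in> tuples D4 2 \<and> zs \<in> D4 \<and> P xss zs"
    by (intro exI[of _ "[[x0, x1, x2, x3], [y0, y1, y2, y3]]"] exI[of _ "[z0, z1, z2, z3]"])
      (simp add: tuples_def)
  then show ?thesis
    by (auto simp: in_tuples_numeral in_tuples_Suc D4_triples_def D4_def)
qed

lemma D4_subset: "D4 \<subseteq> tuples K0 4"
  by (auto simp: D4_def tuples_def L0_K0)

lemma D4_pairs_subset: "D4_pairs P \<subseteq> tuples K0 8"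
  by (auto simp: D4_pairs_def D4_def tuples_def L0_K0)

lemma D4_triples_subset: "D4_triples P \<subseteq> tuples K0 12"
  by (auto simp: D4_triples_def D4_def in_tuples_numeral in_tuples_Suc) (auto simp: tuples_def L0_K0)

lemma U_group_interpretable: "group_structure G interpretable_in M"
proof -
  have dom: "definable M 4 D4"
    by (rule definableI[where p = "Conj (L0_fm 1) (L0_fm 3)" and e = e4])
      (auto simp: D4_subset in_tuples_numeral in_tuples_Suc)
  have ker: "definable M (4 + 4) {xs @ ys | xs ys. xs \<in> D4 \<and> ys \<in> D4 \<and> h4 xs = h4 ys}"
    unfolding D4_pairs_def[symmetric]
    by (rule definableI[where e = e4 and p =
            "Conj (L0_fm 1) (Conj (L0_fm 3) (Conj (Eq (Var 0) (Var 4)) (Conj (Eq (Var 1) (Var 5))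
              (Conj (Eq (Var 2) (Var 6)) (Eq (Var 3) (Var 7))))))"])
      (auto simp: D4_pairs_subset in_D4_pairs in_tuples_numeral in_tuples_Suc)
  \<comment> \<open>Variables 0-3 and 4-7 hold the factors, 8-11 the product, and the formula is
    \<open>u_mult\<close> by coordinates. Membership in \<open>L0\<close> is demanded of the factors
    only, since it follows for the product.\<close>
  have "definable M 12 (D4_triples (\<lambda>xss ys. group_sym_int G Mult (map h4 xss) = h4 ys))"
    by (rule definableI[where e = e4 and p =
            "Conj (L0_fm 1) (Conj (L0_fm 3) (Conj (L0_fm 5) (Conj (L0_fm 7)
              (Conj (Eq (Var 8) (plus_t (Var 0) (Var 4)))
              (Conj (Eq (Var 9) (plus_t (plus_t (Var 1) (Var 5)) (star_t (Var 0) (Var 7))))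
              (Conj (Eq (Var 11) (plus_t (Var 3) (Var 7)))
                    (affine_fm (plus_t (Var 2) (Var 6)) (Var 0) (Var 7) (Var 10))))))))"])
      (auto simp: D4_triples_subset in_D4_triples in_tuples_numeral in_tuples_Suc e4_def)
  then have mul: "definable M (2 * 4 + 4) {concat xss @ ys | xss ys. xss \<in> tuples D4 2 \<and> ys \<in> D4 \<and>
      fun_int (group_structure G) Mult (map h4 xss) = h4 ys}"
    by (simp add: D4_triples_def group_structure_def)
  have "definable M 8 (D4_pairs (\<lambda>xs ys. group_sym_int G Inv [h4 xs] = h4 ys))"
    by (rule definableI[where e = e4 and p =
            "Conj (L0_fm 1) (Conj (L0_fm 3) (Conj (Eq (Var 4) (Var 0))
              (Conj (Eq (Var 5) (plus_t (Var 1) (star_t (Var 0) (Var 3))))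
              (Conj (affine_fm (Var 2) (Var 0) (Var 3) (Var 6)) (Eq (Var 7) (Var 3))))))"])
      (auto simp: D4_pairs_subset in_D4_pairs in_tuples_numeral in_tuples_Suc e4_def)
  then have inv: "definable M (1 * 4 + 4) {concat xss @ ys | xss ys. xss \<in> tuples D4 1 \<and> ys \<in> D4 \<and>
      fun_int (group_structure G) Inv (map h4 xss) = h4 ys}"
    unfolding tuples_1_graph by (simp add: D4_pairs_def group_structure_def)
  have unit: "definable M (0 * 4 + 4) {concat xss @ ys | xss ys. xss \<in> tuples D4 0 \<and> ys \<in> D4 \<and>
      fun_int (group_structure G) Unit (map h4 xss) = h4 ys}"
    by (rule definableI[where e = e4 and p =
            "Conj (Eq (Var 0) (Var 13)) (Conj (Eq (Var 1) (Var 13))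
              (Conj (Eq (Var 2) (Var 13)) (Eq (Var 3) (Var 13))))"])
      (use D4_subset in \<open>auto simp: in_tuples_numeral in_tuples_Suc e4_def group_structure_def\<close>)
  have "interprets_via M (group_structure G) 4 D4 h4"
    unfolding interprets_via_def
    using dom ker mul inv unit h4_image by (simp add: group_structure_def)
  then show ?thesis
    unfolding interpretable_in_def by blast
qed

subsection \<open>The indifferent set in the group\<close>

abbreviation GM :: "(group_sym, unit, ('k^4^4) set) fo_structure" where
  "GM \<equiv> group_structure G"

definition eU :: "nat \<Rightarrow> ('k^4^4) set" where
  "eU i = (if i = 10 then u 1 0 0 0 else if i = 11 then u 0 1 0 0
     else if i = 12 then u 0 0 1 0 else u 0 0 0 1)"

text \<open>Formulas are evaluated under quantifiers, where the environment has been updated. This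
  property retains the parameters and survives updates of the bound variables 14, 20 and 21.\<close>

definition is_env :: "(nat \<Rightarrow> ('k^4^4) set) \<Rightarrow> bool" where
  "is_env f \<longleftrightarrow> f 10 = u 1 0 0 0 \<and> f 11 = u 0 1 0 0 \<and> f 12 = u 0 0 1 0 \<and> f 13 = u 0 0 0 1"

lemma is_envD:
  assumes "is_env f"
  shows "f 10 = u 1 0 0 0" "f 11 = u 0 1 0 0" "f 12 = u 0 0 1 0" "f 13 = u 0 0 0 1"
  using assms by (simp_all add: is_env_def)

lemma is_env_upd [simp]: "is_env f \<Longrightarrow> i \<ge> 14 \<Longrightarrow> is_env (f(i := x))"
  by (simp add: is_env_def)

lemma GM_universe [simp]: "universe GM = carrier G"
  by (simp add: group_structure_def)

lemma trm_val_GM [simp]: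
  "trm_val GM f (mult_t p q) = trm_val GM f p \<otimes>\<^bsub>G\<^esub> trm_val GM f q"
  "trm_val GM f one_t = u 0 0 0 0"
  by (simp_all add: group_structure_def mult_t_def one_t_def)

lemma trm_val_comm_t:
  "trm_val GM f (comm_t p q) = trm_val GM f p \<otimes>\<^bsub>G\<^esub> trm_val GM f q \<otimes>\<^bsub>G\<^esub>
     inv\<^bsub>G\<^esub> (trm_val GM f q \<otimes>\<^bsub>G\<^esub> trm_val GM f p)"
  by (simp add: group_structure_def comm_t_def mult_t_def)

text \<open>U modulo U_2 U_3 is abelian, so commutators lie in U_2 U_3. As this subgroup is central,
  they depend only on the coordinates t and a of their arguments.\<close>

lemma trm_val_comm_t_u [simp]:
  assumes "trm_val GM f p = u t b s a" "trm_val GM f q = u t' b' s' a'"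
    "u t b s a \<in> carrier G" "u t' b' s' a' \<in> carrier G"
  shows "trm_val GM f (comm_t p q) = u 0 (t\<^sup>2 * a' + t'\<^sup>2 * a) (t * a' + t' * a) 0"
  using assms by (simp add: trm_val_comm_t)

lemma wf_GM [simp]:
  "wf_trm GM (mult_t p q) \<longleftrightarrow> wf_trm GM p \<and> wf_trm GM q"
  "wf_trm GM one_t"
  "wf_trm GM (comm_t p q) \<longleftrightarrow> wf_trm GM p \<and> wf_trm GM q"
  "wf_fm GM (in_B i)"
  "wf_fm GM (in_U2_Un_U3 p) \<longleftrightarrow> wf_trm GM p"
  "wf_fm GM (in_U2 p) \<longleftrightarrow> wf_trm GM p"
  "wf_fm GM (in_U3 p) \<longleftrightarrow> wf_trm GM p"
  by (auto simp: group_structure_def mult_t_def one_t_def comm_t_def in_B_def in_U2_Un_U3_def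
      in_U2_def in_U3_def)

section \<open>Defining B and the central root groups\<close>

lemma sat_in_B:
  assumes "is_env f" "f i = u t b s a" "u t b s a \<in> carrier G"
  shows "sat GM f (in_B i) \<longleftrightarrow> t = 0"
  using assms trm_val_comm_t_u[of f "Var i" t b s a "Var 13" 0 0 0 1] by (simp add: in_B_def is_envD)

text \<open>Discharges quantifiers over coordinates on which a commutator does not depend.\<close>

lemma ex_in_K0: "\<exists>x. x \<in> K0" and ex_in_L0: "\<exists>x. x \<in> L0"
  using K0_zero L0_zero by blast+

lemma commutators_with_B:
  assumes "x \<in> L0" "y \<in> K0"
  shows "(\<exists>t\<in>K0. \<exists>a\<in>L0. t\<^sup>2 * a = x \<and> t * a = y) \<longleftrightarrow> (x \<noteq> 0 \<and> y \<noteq> 0) \<or> (x = 0 \<and> y = 0)"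
proof
  assume "(x \<noteq> 0 \<and> y \<noteq> 0) \<or> (x = 0 \<and> y = 0)"
  then show "\<exists>t\<in>K0. \<exists>a\<in>L0. t\<^sup>2 * a = x \<and> t * a = y"
  proof
    assume "x \<noteq> 0 \<and> y \<noteq> 0"
    then show ?thesis
      \<comment> \<open>Solving t^2 a = x and ta = y gives t = x/y and a = y^2/x; the division
        lemmas place them in \<open>K0\<close> and \<open>L0\<close>.\<close>
      using assms by - (rule bexI[of _ "x / y"], rule bexI[of _ "y\<^sup>2 / x"],
          use L0_divide_K0[of x y] K0_square_divide_L0[of x y] in \<open>auto simp: power2_eq_square\<close>)
  next
    assume "x = 0 \<and> y = 0"
    then show ?thesis
      by (intro bexI[of _ 0]) auto
  qed
qed auto

text \<open>Quantifying over c and d in the assumption on z expresses semantically that z is not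
  captured by the bound variables 20 and 21.\<close>

lemma sat_in_U2_Un_U3:
  assumes f: "is_env f" and z: "\<And>c d. trm_val GM (f(20 := c, 21 := d)) z = u 0 x y 0"
    and xy: "x \<in> L0" "y \<in> K0"
  shows "sat GM f (in_U2_Un_U3 z) \<longleftrightarrow> x = 0 \<or> y = 0"
proof -
  have z': "trm_val GM f z = u 0 x y 0"
    using z[of "f 20" "f 21"] by simp
  have "sat GM (f(20 := u t b s a, 21 := u t' b' s' a'))
      (Conj (in_B 21) (Eq (comm_t (Var 20) (Var 21)) z)) \<longleftrightarrow> t' = 0 \<and> t\<^sup>2 * a' = x \<and> t * a' = y"
    if mem: "t \<in> K0" "b \<in> L0" "s \<in> K0" "a \<in> L0" "t' \<in> K0" "b' \<in> L0" "s' \<in> K0" "a' \<in> L0"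
    for t b s a t' b' s' a'
  proof -
    let ?f = "f(20 := u t b s a, 21 := u t' b' s' a')"
    have "trm_val GM ?f (comm_t (Var 20) (Var 21)) = u 0 (t\<^sup>2 * a' + t'\<^sup>2 * a) (t * a' + t' * a) 0"
      using mem by (intro trm_val_comm_t_u[where b = b and s = s and b' = b' and s' = s']) auto
    moreover have "sat GM ?f (in_B 21) \<longleftrightarrow> t' = 0"
      using f mem by (intro sat_in_B[where b = b' and s = s' and a = a']) auto
    ultimately show ?thesis
      by (auto simp: z)
  qed
  moreover have "sat GM f (Eq z one_t) \<longleftrightarrow> x = 0 \<and> y = 0"
    by (simp add: z')
  ultimately have "sat GM f (in_U2_Un_U3 z) \<longleftrightarrow>
      x = 0 \<and> y = 0 \<or> \<not> (\<exists>t\<in>K0. \<exists>a'\<in>L0. t\<^sup>2 * a' = x \<and> t * a' = y)"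
    unfolding in_U2_Un_U3_def sat.simps(3-5) GM_universe bex_carrier_G
    by (auto simp: bex_carrier_G ex_in_K0 ex_in_L0 simp del: sat.simps)
  then show ?thesis
    unfolding commutators_with_B[OF xy] by auto
qed

text \<open>Multiplying by x_2(1) replaces x by x + 1. Since x and x + 1 cannot both vanish, the two
  conditions together force y = 0.\<close>

lemma sat_in_U2:
  assumes f: "is_env f" and z: "\<And>c d. trm_val GM (f(20 := c, 21 := d)) z = u 0 x y 0"
    and xy: "x \<in> L0" "y \<in> K0"
  shows "sat GM f (in_U2 z) \<longleftrightarrow> y = 0"
proof -
  have "sat GM f (in_U2_Un_U3 (mult_t z (Var 11))) \<longleftrightarrow> x + 1 = 0 \<or> y = 0"
    using xy by (intro sat_in_U2_Un_U3 f) (auto simp: z is_envD[OF f])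
  then show ?thesis
    using sat_in_U2_Un_U3[OF assms] by (auto simp: in_U2_def)
qed

lemma sat_in_U3:
  assumes f: "is_env f" and z: "\<And>c d. trm_val GM (f(20 := c, 21 := d)) z = u 0 x y 0"
    and xy: "x \<in> L0" "y \<in> K0"
  shows "sat GM f (in_U3 z) \<longleftrightarrow> x = 0"
proof -
  have "sat GM f (in_U2_Un_U3 (mult_t z (Var 12))) \<longleftrightarrow> x = 0 \<or> y + 1 = 0"
    using xy by (intro sat_in_U2_Un_U3 f) (auto simp: z is_envD[OF f])
  then show ?thesis
    using sat_in_U2_Un_U3[OF assms] by (auto simp: in_U3_def)
qed

section \<open>The coordinate map and the formulas for the operations\<close>

definition D1 :: "('k^4^4) set list set" where
  "D1 = tuples (carrier G) 1"

text \<open>Elements of U are singletons of matrices, hence \<open>the_elem\<close>; the entry (1,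
  2) of the matrix is the coordinate t.\<close>

definition h1 :: "('k^4^4) set list \<Rightarrow> 'k" where
  "h1 xs = the_elem (hd xs) $ 1 $ 2"

lemma h1_simp [simp]: "h1 [u t b s a] = t"
  by (simp add: h1_def u_def umat_entry_1_2)

lemma in_D1: "xs \<in> D1 \<longleftrightarrow> (\<exists>g\<in>carrier G. xs = [g])"
  by (auto simp: D1_def in_tuples_Suc)

lemma h1_image: "h1 ` D1 = K0"
proof
  show "h1 ` D1 \<subseteq> K0"
    by (auto simp: in_D1 carrier_G)
  show "K0 \<subseteq> h1 ` D1"
  proof
    fix t assume "t \<in> K0"
    then have "t = h1 [u t 0 0 0]" "[u t 0 0 0] \<in> D1"
      by (auto simp: in_D1)
    then show "t \<in> h1 ` D1"
      by blast
  qed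
qed

definition D1_triples :: "(('k^4^4) set list list \<Rightarrow> ('k^4^4) set list \<Rightarrow> bool) \<Rightarrow> ('k^4^4) set list set" where
  "D1_triples P = {concat xss @ zs | xss zs. xss \<in> tuples D1 2 \<and> zs \<in> D1 \<and> P xss zs}"

lemma D1_triples_eq:
  "D1_triples P = {[x, y, z] | x y z. x \<in> carrier G \<and> y \<in> carrier G \<and> z \<in> carrier G \<and> P [[x], [y]] [z]}"
proof
  show "{[x, y, z] | x y z. x \<in> carrier G \<and> y \<in> carrier G \<and> z \<in> carrier G \<and> P [[x], [y]] [z]} \<subseteq> D1_triples P"
  proof clarify
    fix x y z
    assume "x \<in> carrier G" "y \<in> carrier G" "z \<in> carrier G" "P [[x], [y]] [z]"
    then show "[x, y, z] \<in> D1_triples P"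
      unfolding D1_triples_def
      by (intro CollectI exI[of _ "[[x], [y]]"] exI[of _ "[z]"]) (simp add: in_D1 tuples_def)
  qed
qed (auto simp: D1_triples_def in_D1 in_tuples_numeral in_tuples_Suc)

lemma D1_pairs_eq:
  "{xs @ ys | xs ys. xs \<in> D1 \<and> ys \<in> D1 \<and> P xs ys} =
     {[x, y] | x y. x \<in> carrier G \<and> y \<in> carrier G \<and> P [x] [y]}"
proof
  show "{[x, y] | x y. x \<in> carrier G \<and> y \<in> carrier G \<and> P [x] [y]} \<subseteq>
      {xs @ ys | xs ys. xs \<in> D1 \<and> ys \<in> D1 \<and> P xs ys}"
  proof clarify
    fix x y
    assume "x \<in> carrier G" "y \<in> carrier G" "P [x] [y]"
    then show "\<exists>xs ys. [x, y] = xs @ ys \<and> xs \<in> D1 \<and> ys \<in> D1 \<and> P xs ys"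
      by (intro exI[of _ "[x]"] exI[of _ "[y]"]) (simp add: in_D1)
  qed
qed (auto simp: in_D1)

lemma eU_in_carrier: "range eU \<subseteq> carrier G"
  by (auto simp: eU_def)

lemma is_env_eU: "n \<le> 10 \<Longrightarrow> is_env (\<lambda>i. if i < n then xs ! i else eU i)"
  by (simp add: is_env_def eU_def)

definition L0_U :: "(group_sym, unit) fm" where
  "L0_U = Ex 14 (Conj (in_B 14)
     (in_U2 (mult_t (comm_t (Var 0) (Var 13)) (comm_t (Var 10) (Var 14)))))"

text \<open>Let g_i be the value of variable i. Membership in U_3 selects v with a = t_0^2. The x_3
  coordinates of [g_1, v] and [g_2, x_4(1)] are then t_1 t_0^2 and t_2, and membership in U_2 says
  that they agree.\<close>

definition star_U :: "(group_sym, unit) fm" where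
  "star_U = Ex 14 (Conj (in_B 14) (Conj
     (in_U3 (mult_t (comm_t (Var 0) (Var 13)) (comm_t (Var 10) (Var 14))))
     (in_U2 (mult_t (comm_t (Var 1) (Var 14)) (comm_t (Var 2) (Var 13))))))"

definition plus_U :: "(group_sym, unit) fm" where
  "plus_U = Eq (comm_t (mult_t (Var 0) (Var 1)) (Var 13)) (comm_t (Var 2) (Var 13))"

lemma wf_U [simp]: "wf_fm GM L0_U" "wf_fm GM star_U" "wf_fm GM plus_U"
  by (simp_all add: L0_U_def star_U_def plus_U_def)

text \<open>The commutator with x_4(1) determines t, so equality of t-coordinates becomes an
  equation between commutators. This gives the kernel of \<open>h1\<close> and the formula for the
  sum.\<close>

lemma trm_val_comm_x4:
  assumes "is_env f" "trm_val GM f p = u t b s a" "u t b s a \<in> carrier G"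
  shows "trm_val GM f (comm_t p (Var 13)) = u 0 (t\<^sup>2) t 0"
  using assms trm_val_comm_t_u[of f p t b s a "Var 13" 0 0 0 1] by (simp add: is_envD)

lemma trm_val_comm_x1:
  assumes "is_env f" "trm_val GM f p = u 0 b s a" "u 0 b s a \<in> carrier G"
  shows "trm_val GM f (comm_t (Var 10) p) = u 0 a a 0"
  using assms trm_val_comm_t_u[of f "Var 10" 1 0 0 0 p 0 b s a] by (simp add: is_envD)

text \<open>Membership in U_2 forces the coordinate a of the witness to be t, and this coordinate
  ranges over exactly \<open>L0\<close>.\<close>

lemma sat_L0_U:
  assumes f: "is_env f" "f 0 = u t b s a" and mem: "u t b s a \<in> carrier G"
  shows "sat GM f L0_U \<longleftrightarrow> t \<in> L0"
proof -
  have "sat GM (f(14 := u 0 b' s' a')) (in_U2 (mult_t (comm_t (Var 0) (Var 13)) (comm_t (Var 10) (Var 14))))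
      \<longleftrightarrow> t + a' = 0"
    if "b' \<in> L0" "s' \<in> K0" "a' \<in> L0" for b' s' a'
    using f mem that
    \<comment> \<open>The U_2 coordinate is absent from the conclusion of \<open>sat_in_U2\<close>
      and has to be supplied.\<close>
    by (intro sat_in_U2[where x = "t\<^sup>2 + a'"])
      (auto simp: trm_val_comm_x4[where t = t and b = b and s = s and a = a]
        trm_val_comm_x1[where b = b' and s = s' and a = a'] L0_K0)
  moreover have "sat GM (f(14 := u t' b' s' a')) (in_B 14) \<longleftrightarrow> t' = 0"
    if "u t' b' s' a' \<in> carrier G" for t' b' s' a'
    using f that by (intro sat_in_B[where b = b' and s = s' and a = a']) auto
  ultimately show ?thesis
    unfolding L0_U_def sat.simps(4,5) GM_universe bex_carrier_G
    by (auto simp: ex_in_K0 ex_in_L0 simp del: sat.simps)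
qed

text \<open>A witness with a = t_0^2 always exists, because every square lies in
  \<open>L0\<close>.\<close>

lemma sat_star_U:
  assumes f: "is_env f" "f 0 = u t0 b0 s0 a0" "f 1 = u t1 b1 s1 a1" "f 2 = u t2 b2 s2 a2"
    and mem: "u t0 b0 s0 a0 \<in> carrier G" "u t1 b1 s1 a1 \<in> carrier G" "u t2 b2 s2 a2 \<in> carrier G"
  shows "sat GM f star_U \<longleftrightarrow> t0\<^sup>2 * t1 = t2"
proof -
  have "sat GM (f(14 := u 0 b' s' a')) (in_U3 (mult_t (comm_t (Var 0) (Var 13)) (comm_t (Var 10) (Var 14))))
      \<longleftrightarrow> t0\<^sup>2 + a' = 0"
    if "b' \<in> L0" "s' \<in> K0" "a' \<in> L0" for b' s' a'
    using f mem that
    by (intro sat_in_U3[where y = "t0 + a'"])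
      (auto simp: trm_val_comm_x4[where t = t0 and b = b0 and s = s0 and a = a0]
        trm_val_comm_x1[where b = b' and s = s' and a = a'] L0_K0)
  moreover have "sat GM (f(14 := u 0 b' s' a')) (in_U2 (mult_t (comm_t (Var 1) (Var 14)) (comm_t (Var 2) (Var 13))))
      \<longleftrightarrow> t1 * a' + t2 = 0"
    if "b' \<in> L0" "s' \<in> K0" "a' \<in> L0" for b' s' a'
    using f mem that
    by (intro sat_in_U2[where x = "t1\<^sup>2 * a' + t2\<^sup>2"])
      (auto simp: trm_val_comm_x4[where t = t2 and b = b2 and s = s2 and a = a2]
        trm_val_comm_t_u[where t = t1 and b = b1 and s = s1 and a = a1 and t' = 0 and b' = b' and s' = s' and a' = a'])
  moreover have "sat GM (f(14 := u t' b' s' a')) (in_B 14) \<longleftrightarrow> t' = 0"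
    if "u t' b' s' a' \<in> carrier G" for t' b' s' a'
    using f that by (intro sat_in_B[where b = b' and s = s' and a = a']) auto
  ultimately show ?thesis
    unfolding star_U_def sat.simps(4,5) GM_universe bex_carrier_G
    by (auto simp: ex_in_K0 ex_in_L0 mult.commute simp del: sat.simps)
qed

lemma sat_plus_U:
  assumes f: "is_env f" "f 0 = u t0 b0 s0 a0" "f 1 = u t1 b1 s1 a1" "f 2 = u t2 b2 s2 a2"
    and mem: "u t0 b0 s0 a0 \<in> carrier G" "u t1 b1 s1 a1 \<in> carrier G" "u t2 b2 s2 a2 \<in> carrier G"
  shows "sat GM f plus_U \<longleftrightarrow> t0 + t1 = t2"
proof -
  have "trm_val GM f (comm_t (mult_t (Var 0) (Var 1)) (Var 13)) = u 0 ((t0 + t1)\<^sup>2) (t0 + t1) 0"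
    using f mem by (intro trm_val_comm_x4) auto
  moreover have "trm_val GM f (comm_t (Var 2) (Var 13)) = u 0 (t2\<^sup>2) t2 0"
    using f mem by (intro trm_val_comm_x4) auto
  ultimately show ?thesis
    by (auto simp: plus_U_def)
qed

lemma indiff_structure_interpretable: "M interpretable_in GM"
proof -
  have dom: "definable GM 1 D1"
    by (rule definableI[where p = "Eq (Var 0) (Var 0)" and e = eU]) (auto simp: D1_def eU_in_carrier)
  have "definable GM 2 {[x, y] | x y. x \<in> carrier G \<and> y \<in> carrier G \<and> h1 [x] = h1 [y]}"
  proof (rule definableI[where p = "Eq (comm_t (Var 0) (Var 13)) (comm_t (Var 1) (Var 13))" and e = eU])
    fix xs
    assume "xs \<in> tuples (universe GM) 2"
    then obtain t0 b0 s0 a0 t1 b1 s1 a1 where xs: "xs = [u t0 b0 s0 a0, u t1 b1 s1 a1]"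
      and mem: "u t0 b0 s0 a0 \<in> carrier G" "u t1 b1 s1 a1 \<in> carrier G"
      by (auto simp: in_tuples_numeral in_tuples_Suc carrier_G)
    let ?f = "\<lambda>i. if i < 2 then xs ! i else eU i"
    have "trm_val GM ?f (comm_t (Var 0) (Var 13)) = u 0 (t0\<^sup>2) t0 0"
      "trm_val GM ?f (comm_t (Var 1) (Var 13)) = u 0 (t1\<^sup>2) t1 0"
      using mem
      by (simp_all add: xs is_env_eU trm_val_comm_x4[where b = b0 and s = s0 and a = a0]
          trm_val_comm_x4[where b = b1 and s = s1 and a = a1])
    then show "xs \<in> {[x, y] | x y. x \<in> carrier G \<and> y \<in> carrier G \<and> h1 [x] = h1 [y]} \<longleftrightarrow>
        sat GM ?f (Eq (comm_t (Var 0) (Var 13)) (comm_t (Var 1) (Var 13)))"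
      using mem by (auto simp: xs)
  qed (auto simp: eU_in_carrier tuples_def)
  then have ker: "definable GM (1 + 1) {xs @ ys | xs ys. xs \<in> D1 \<and> ys \<in> D1 \<and> h1 xs = h1 ys}"
    unfolding D1_pairs_eq by (simp add: numeral_2_eq_2)
  \<comment> \<open>Both operations have graphs in three variables. This turns an evaluation of p,
    valid in every environment with the right parameters, into definability of the graph.\<close>
  have triple: "definable GM 3 (D1_triples P)"
    if wf: "wf_fm GM p" and sat: "\<And>f t0 b0 s0 a0 t1 b1 s1 a1 t2 b2 s2 a2.
        \<lbrakk>is_env f; f 0 = u t0 b0 s0 a0; f 1 = u t1 b1 s1 a1; f 2 = u t2 b2 s2 a2;
         u t0 b0 s0 a0 \<in> carrier G; u t1 b1 s1 a1 \<in> carrier G; u t2 b2 s2 a2 \<in> carrier G\<rbrakk> \<Longrightarrow>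
         sat GM f p \<longleftrightarrow> P [[u t0 b0 s0 a0], [u t1 b1 s1 a1]] [u t2 b2 s2 a2]"
    for p P
  proof (rule definableI[where p = p and e = eU])
    fix xs
    assume "xs \<in> tuples (universe GM) 3"
    then obtain t0 b0 s0 a0 t1 b1 s1 a1 t2 b2 s2 a2
      where xs: "xs = [u t0 b0 s0 a0, u t1 b1 s1 a1, u t2 b2 s2 a2]"
        and mem: "u t0 b0 s0 a0 \<in> carrier G" "u t1 b1 s1 a1 \<in> carrier G" "u t2 b2 s2 a2 \<in> carrier G"
      by (auto simp: in_tuples_numeral in_tuples_Suc carrier_G)
    have "sat GM (\<lambda>i. if i < 3 then xs ! i else eU i) p \<longleftrightarrow>
        P [[u t0 b0 s0 a0], [u t1 b1 s1 a1]] [u t2 b2 s2 a2]"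
      using mem by (intro sat is_env_eU) (auto simp: xs)
    with mem show "xs \<in> D1_triples P \<longleftrightarrow> sat GM (\<lambda>i. if i < 3 then xs ! i else eU i) p"
      by (simp add: D1_triples_eq xs)
  qed (use wf in \<open>auto simp: eU_in_carrier tuples_def D1_triples_eq\<close>)
  have "definable GM 3 (D1_triples (\<lambda>xss ys. indiff_fun_int Plus (map h1 xss) = h1 ys))"
    by (rule triple[of plus_U]) (simp_all add: sat_plus_U del: u_in_carrier)
  then have plus: "definable GM (2 * 1 + 1) {concat xss @ ys | xss ys. xss \<in> tuples D1 2 \<and> ys \<in> D1 \<and>
      fun_int M Plus (map h1 xss) = h1 ys}"
    by (simp add: D1_triples_def indiff_structure_def)
  have "definable GM 3 (D1_triples (\<lambda>xss ys. indiff_fun_int Star (map h1 xss) = h1 ys))"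
    by (rule triple[of star_U]) (simp_all add: sat_star_U del: u_in_carrier)
  then have star: "definable GM (2 * 1 + 1) {concat xss @ ys | xss ys. xss \<in> tuples D1 2 \<and> ys \<in> D1 \<and>
      fun_int M Star (map h1 xss) = h1 ys}"
    by (simp add: D1_triples_def indiff_structure_def)
  have rel_eq: "{concat xss | xss. xss \<in> tuples D1 1 \<and> rel_int M InL0 (map h1 xss)} =
      {[x] | x. x \<in> carrier G \<and> h1 [x] \<in> L0}" (is "?L = ?R")
  proof
    show "?R \<subseteq> ?L"
    proof clarify
      fix x assume "x \<in> carrier G" "h1 [x] \<in> L0"
      then show "\<exists>xss. [x] = concat xss \<and> xss \<in> tuples D1 1 \<and> rel_int M InL0 (map h1 xss)"
        by (intro exI[of _ "[[x]]"]) (simp add: in_D1 tuples_def indiff_structure_def)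
    qed
  qed (auto simp: in_D1 in_tuples_Suc indiff_structure_def)
  have "definable GM 1 {[x] | x. x \<in> carrier G \<and> h1 [x] \<in> L0}"
  proof (rule definableI[where p = L0_U and e = eU])
    fix xs
    assume "xs \<in> tuples (universe GM) 1"
    then obtain t b s a where xs: "xs = [u t b s a]" and mem: "u t b s a \<in> carrier G"
      by (auto simp: in_tuples_Suc carrier_G)
    have "sat GM (\<lambda>i. if i < 1 then xs ! i else eU i) L0_U \<longleftrightarrow> t \<in> L0"
      using mem by (intro sat_L0_U is_env_eU) (auto simp: xs)
    with mem show "xs \<in> {[x] | x. x \<in> carrier G \<and> h1 [x] \<in> L0} \<longleftrightarrow>
        sat GM (\<lambda>i. if i < 1 then xs ! i else eU i) L0_U"
      by (simp add: xs)
  qed (auto simp: eU_in_carrier tuples_def)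
  then have rel: "definable GM (1 * 1) {concat xss | xss. xss \<in> tuples D1 1 \<and> rel_int M InL0 (map h1 xss)}"
    unfolding rel_eq by simp
  have "interprets_via GM M 1 D1 h1"
    unfolding interprets_via_def M_simps(1)
    using dom ker plus star rel h1_image by (auto simp: indiff_structure_def)
  then show ?thesis
    unfolding interpretable_in_def by blast
qed

end

theorem theorem7p2:
  fixes K0 L0 :: "'k::field set"
  assumes "weak_indifferent_set K0 L0"
  shows "group_structure (U_group L0 K0) interpretable_in indiff_structure K0 L0 \<and>
         indiff_structure K0 L0 interpretable_in group_structure (U_group L0 K0)"
  using weak_indifferent.U_group_interpretable weak_indifferent.indiff_structure_interpretable
    weak_indifferent.intro[OF assms] by blast

end
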